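(* Let $R$ be a commutative ring with identity such that $2\in R^\times$, let $C\in\operatorname{Mat}_2(R)$ be cyclic, and put $\tau=\operatorname{tr}(C)$, $\nu=\det(C)$. Then $$\Gamma_C(R)=\Sigma_C(R)I_2=\left\{tI_2 : t\in R^\times,\ (t-1)\tau=0,\ (t^2-1)\nu=0\right\}.$$
   Context: A matrix $C\in\operatorname{Mat}_2(R)$ is cyclic if there exists $v\in R^2$ such that $(v,Cv)$ is an $R$-basis of $R^2$. The similarity orbit is $\operatorname{Orb}(C)=\{PCP^{-1}:P\in\operatorname{GL}_2(R)\}$. The left stabilizer of the orbit is $\Gamma_C(R):=\{H\in\operatorname{GL}_2(R):H\operatorname{Orb}(C)=\operatorname{Orb}(C)\}$, where $H\operatorname{Orb}(C)=\{HK:K\in\operatorname{Orb}(C)\}$. The scalar-symmetry group is $\Sigma_C(R):=\{t\in R^\times : tC\text{ is similar to }C\text{ over }R\}$ (similar means conjugate under $\operatorname{GL}_2(R)$). $I_2$ is the identity matrix. *)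

theory Defs
  imports "HOL-Analysis.Analysis"
begin

text \<open>
  Commutative rings are rendered by the class \<open>comm_ring_1\<close>, which includes \<open>0 \<noteq> 1\<close>; the
  library's matrix product, trace and determinant need this. Over the zero ring there is only
  one matrix.
\<close>

text \<open>
  The ordered pair \<open>(u, w)\<close> is a basis of the free module \<open>R\<^sup>2\<close>. The library notions of
  independence and span are about sets, so \<open>u \<noteq> w\<close> is needed to speak about the family
  \<open>(u, w)\<close>. The library's interpretation \<open>vec\<close> is only available over fields, hence the
  constants of the locale \<open>module\<close> are used with an explicit scalar multiplication.
\<close>

definition basis_pair :: "'a::comm_ring_1 ^ 2 \<Rightarrow> 'a ^ 2 \<Rightarrow> bool" where
  "basis_pair u w \<longleftrightarrow>
     u \<noteq> w \<and> \<not> module.dependent (*s) {u, w} \<and> module.span (*s) {u, w} = UNIV"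

definition cyclic_matrix :: "'a::comm_ring_1 ^ 2 ^ 2 \<Rightarrow> bool" where
  "cyclic_matrix C \<longleftrightarrow> (\<exists>v. basis_pair v (C *v v))"

definition similar_matrix :: "'a::comm_ring_1 ^ 2 ^ 2 \<Rightarrow> 'a ^ 2 ^ 2 \<Rightarrow> bool" where
  "similar_matrix A B \<longleftrightarrow> (\<exists>P. invertible P \<and> A = P ** B ** matrix_inv P)"

definition similarity_orbit :: "'a::comm_ring_1 ^ 2 ^ 2 \<Rightarrow> ('a ^ 2 ^ 2) set" where
  "similarity_orbit C = {P ** C ** matrix_inv P | P. invertible P}"

definition left_stabilizer :: "'a::comm_ring_1 ^ 2 ^ 2 \<Rightarrow> ('a ^ 2 ^ 2) set" where
  "left_stabilizer C =
     {H. invertible H \<and> (\<lambda>K. H ** K) ` similarity_orbit C = similarity_orbit C}"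

definition scalar_symmetry_group :: "'a::comm_ring_1 ^ 2 ^ 2 \<Rightarrow> 'a set" where
  "scalar_symmetry_group C = {t. t dvd 1 \<and> similar_matrix (map_matrix ((*) t) C) C}"

text \<open>
  Sanity check: \<open>basis_pair\<close> is the usual notion for families, spelled out in coordinates.
\<close>

lemma module_vector_scalar_mult: "module ((*s) :: 'a::comm_ring_1 \<Rightarrow> 'a ^ 2 \<Rightarrow> 'a ^ 2)"
  by unfold_locales (simp_all add: vec_eq_iff algebra_simps)

lemma basis_pair_iff:
  fixes u w :: "'a::comm_ring_1 ^ 2"
  shows "basis_pair u w \<longleftrightarrow>
    (\<forall>a b. a *s u + b *s w = 0 \<longrightarrow> a = 0 \<and> b = 0) \<and> (\<forall>x. \<exists>a b. x = a *s u + b *s w)"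
proof (cases "u = w")
  case True
  then have "1 *s u + (- 1) *s w = 0" by (simp add: vec_eq_iff)
  then show ?thesis
    using True unfolding basis_pair_def by (metis one_neq_zero)
next
  case assms: False
  interpret m: module "(*s) :: 'a \<Rightarrow> 'a ^ 2 \<Rightarrow> 'a ^ 2"
    by (rule module_vector_scalar_mult)
  have "m.dependent {u, w} \<longleftrightarrow> (\<exists>f. f u *s u + f w *s w = 0 \<and> (f u \<noteq> 0 \<or> f w \<noteq> 0))"
    using assms by (subst m.dependent_finite) auto
  also have "\<dots> \<longleftrightarrow> (\<exists>a b. a *s u + b *s w = 0 \<and> (a \<noteq> 0 \<or> b \<noteq> 0))" (is "?l \<longleftrightarrow> ?r")
  proof
    assume ?r
    then obtain a b where "a *s u + b *s w = 0" "a \<noteq> 0 \<or> b \<noteq> 0" by blast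
    then show ?l using assms by (intro exI[of _ "\<lambda>x. if x = u then a else b"]) auto
  qed blast
  finally have dep: "m.dependent {u, w} \<longleftrightarrow> \<dots>" .
  have "x \<in> m.span {u, w} \<longleftrightarrow> (\<exists>a b. x = a *s u + b *s w)" for x
    by (auto simp: m.span_insert m.span_singleton algebra_simps)
  then have "m.span {u, w} = UNIV \<longleftrightarrow> (\<forall>x. \<exists>a b. x = a *s u + b *s w)"
    by blast
  with dep assms show ?thesis unfolding basis_pair_def by blast
qed

end

theory Submission
  imports Defs
begin

text \<open>
  A cyclic matrix \<open>C\<close> is similar to the companion matrix \<open>K\<close> of \<open>X\<^sup>2 - \<tau> X + \<nu>\<close>: the basis
  \<open>(v, C v)\<close> is the change of coordinates, by Cayley-Hamilton (\<open>cyclic_similar_companion\<close>). So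
  the orbit of \<open>C\<close>, on which the stabilizer depends, is the orbit of \<open>K\<close>, and \<open>t C\<close> is similar
  to \<open>C\<close> precisely if \<open>t K\<close> is similar to \<open>K\<close>.

  If \<open>H\<close> stabilizes the orbit of \<open>K\<close> then \<open>H L\<close> has trace \<open>\<tau>\<close> for every conjugate \<open>L\<close> of \<open>K\<close>.
  For the conjugates of \<open>K\<close> by the upper unipotent matrices with corner entry \<open>x\<close>, this trace is
  a quadratic polynomial in \<open>x\<close>; its values at \<open>0, 1, -1\<close> and the conjugate by the diagonal
  matrix \<open>(1, -1)\<close> suffice, as \<open>2\<close> is a unit, to force \<open>H\<close> to be a scalar \<open>t\<close>
  (\<open>trace_stabilizer_scalar\<close>). Since \<open>t C\<close> lies in the orbit, \<open>t\<close> is a scalar symmetry. A scalar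
  symmetry preserves trace and determinant, which gives the two equations. Conversely, under
  these equations the diagonal matrix \<open>(1, t)\<close> conjugates \<open>K\<close> to \<open>t K\<close>
  (\<open>companion_scalar_symmetry\<close>). Finally scalar matrices are central, so a scalar symmetry
  maps the whole orbit onto itself (\<open>scalar_mem_left_stabilizer_iff\<close>).
\<close>

section \<open>Matrices of size two over a commutative ring\<close>

definition matrix2 :: "'a::comm_ring_1 \<Rightarrow> 'a \<Rightarrow> 'a \<Rightarrow> 'a \<Rightarrow> 'a ^ 2 ^ 2" where
  "matrix2 a b c d = vector [vector [a, b], vector [c, d]]"

lemma matrix2_nth [simp]:
  "matrix2 a b c d $ 1 $ 1 = a" "matrix2 a b c d $ 1 $ 2 = b"
  "matrix2 a b c d $ 2 $ 1 = c" "matrix2 a b c d $ 2 $ 2 = d"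
  by (simp_all add: matrix2_def)

lemma matrix2_cases:
  fixes A :: "'a::comm_ring_1 ^ 2 ^ 2"
  obtains a b c d where "A = matrix2 a b c d"
proof
  show "A = matrix2 (A$1$1) (A$1$2) (A$2$1) (A$2$2)"
    by (simp add: vec_eq_iff forall_2)
qed

lemma matrix2_eq_iff [simp]:
  "matrix2 a b c d = matrix2 a' b' c' d' \<longleftrightarrow> a = a' \<and> b = b' \<and> c = c' \<and> d = d'"
  by (auto simp: vec_eq_iff forall_2)

lemma matrix2_mult [simp]:
  "matrix2 a b c d ** matrix2 a' b' c' d' =
    matrix2 (a*a' + b*c') (a*b' + b*d') (c*a' + d*c') (c*b' + d*d')"
  by (simp add: vec_eq_iff forall_2 matrix_matrix_mult_def sum_2)

lemma mat_eq_matrix2: "mat t = matrix2 t 0 0 t"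
  by (simp add: vec_eq_iff forall_2 mat_def)

lemma trace_matrix2 [simp]: "trace (matrix2 a b c d) = a + d"
  by (simp add: trace_def sum_2)

lemma det_matrix2 [simp]: "det (matrix2 a b c d) = a * d - b * c"
  by (simp add: det_2)

lemma map_matrix_times: "map_matrix ((*) t) A = mat t ** (A :: 'a::comm_ring_1 ^ 2 ^ 2)"
  by (cases A rule: matrix2_cases)
     (simp add: mat_eq_matrix2, simp add: vec_eq_iff forall_2 map_matrix_def)

lemma mat_commute: "mat t ** A = A ** mat t" for A :: "'a::comm_ring_1 ^ 2 ^ 2"
  by (cases A rule: matrix2_cases) (simp add: mat_eq_matrix2 mult.commute)

lemma mat_mult_mat: "mat s ** mat t = (mat (s * t) :: 'a::comm_ring_1 ^ 2 ^ 2)"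
  by (simp add: mat_eq_matrix2)

text \<open>The inverse is the adjugate divided by the determinant.\<close>

lemma right_inverse_imp_left_inverse:
  fixes P Q :: "'a::comm_ring_1 ^ 2 ^ 2"
  assumes "P ** Q = mat 1"
  shows "Q ** P = mat 1"
proof -
  obtain a b c d where P: "P = matrix2 a b c d" by (rule matrix2_cases)
  have "det P * det Q = 1"
    using assms by (metis det_I det_mul)
  then have e: "det Q * (a * d - b * c) = 1"
    by (simp add: P mult.commute)
  define R where "R = mat (det Q) ** matrix2 d (- b) (- c) a"
  have R: "R ** P = mat 1"
    using e by (simp add: R_def P mat_eq_matrix2 algebra_simps)
  have "R = R ** (P ** Q)" using assms by simp
  also have "\<dots> = Q" using R by (simp add: matrix_mul_assoc)
  finally show ?thesis using R by simp
qed

lemma scalar_matrix_invertible_iff: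
  "invertible (mat t :: 'a::comm_ring_1 ^ 2 ^ 2) \<longleftrightarrow> t dvd 1"
proof
  assume "invertible (mat t :: 'a ^ 2 ^ 2)"
  then obtain Q :: "'a ^ 2 ^ 2" where Q: "mat t ** Q = mat 1" unfolding invertible_def by blast
  then show "t dvd 1"
    by (cases Q rule: matrix2_cases) (auto simp: mat_eq_matrix2 intro: dvdI)
next
  assume "t dvd 1"
  then obtain s where "1 = t * s" by (rule dvdE)
  then show "invertible (mat t :: 'a ^ 2 ^ 2)"
    unfolding invertible_def
    by (intro exI[of _ "mat s"]) (simp add: mat_mult_mat mult.commute)
qed

section \<open>Similarity\<close>

lemma invertible_right_inverse_matrix_inv:
  fixes P :: "'a::comm_ring_1 ^ 2 ^ 2"
  assumes "invertible P"
  shows "P ** matrix_inv P = mat 1"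
  unfolding matrix_inv_def
  using someI_ex[OF assms[unfolded invertible_def]] by (rule conjunct1)

text \<open>
  The chosen inverse \<open>matrix_inv P\<close> is replaced by an arbitrary matrix \<open>Q\<close> with \<open>P Q = 1\<close>, so
  that similarities can be composed and inverted by computing in the matrix ring.
\<close>

lemma similar_matrix_iff:
  fixes A B :: "'a::comm_ring_1 ^ 2 ^ 2"
  shows "similar_matrix A B \<longleftrightarrow> (\<exists>P Q. P ** Q = mat 1 \<and> A = P ** B ** Q)"
proof
  assume "similar_matrix A B"
  then obtain P where P: "invertible P" "A = P ** B ** matrix_inv P"
    unfolding similar_matrix_def by blast
  have "P ** matrix_inv P = mat 1" by (rule invertible_right_inverse_matrix_inv[OF P(1)])
  with P(2) show "\<exists>P Q. P ** Q = mat 1 \<and> A = P ** B ** Q" by blast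
next
  assume "\<exists>P Q. P ** Q = mat 1 \<and> A = P ** B ** Q"
  then obtain P Q where PQ: "P ** Q = mat 1" "A = P ** B ** Q" by blast
  have QP: "Q ** P = mat 1" by (rule right_inverse_imp_left_inverse[OF PQ(1)])
  have inv: "invertible P" using PQ(1) QP unfolding invertible_def by blast
  have "P ** matrix_inv P = mat 1" by (rule invertible_right_inverse_matrix_inv[OF inv])
  then have "Q ** P ** matrix_inv P = Q"
    by (simp flip: matrix_mul_assoc)
  then have "matrix_inv P = Q" by (simp add: QP)
  with inv PQ(2) show "similar_matrix A B" unfolding similar_matrix_def by blast
qed

lemma similar_matrix_refl: "similar_matrix A (A :: 'a::comm_ring_1 ^ 2 ^ 2)"
  unfolding similar_matrix_iff by (intro exI[of _ "mat 1"]) simp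

lemma similar_matrix_sym:
  fixes A B :: "'a::comm_ring_1 ^ 2 ^ 2"
  assumes "similar_matrix A B"
  shows "similar_matrix B A"
proof -
  obtain P Q where PQ: "P ** Q = mat 1" "A = P ** B ** Q"
    using assms unfolding similar_matrix_iff by blast
  have QP: "Q ** P = mat 1" by (rule right_inverse_imp_left_inverse[OF PQ(1)])
  have "Q ** A ** P = (Q ** P) ** B ** (Q ** P)"
    by (simp only: PQ(2) matrix_mul_assoc)
  then have "B = Q ** A ** P" by (simp add: QP)
  with QP show ?thesis unfolding similar_matrix_iff by blast
qed

lemma similar_matrix_trans:
  fixes A B D :: "'a::comm_ring_1 ^ 2 ^ 2"
  assumes "similar_matrix A B" "similar_matrix B D"
  shows "similar_matrix A D"
proof -
  obtain P Q where PQ: "P ** Q = mat 1" "A = P ** B ** Q"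
    using assms(1) unfolding similar_matrix_iff by blast
  obtain P' Q' where PQ': "P' ** Q' = mat 1" "B = P' ** D ** Q'"
    using assms(2) unfolding similar_matrix_iff by blast
  have "(P ** P') ** (Q' ** Q) = P ** (P' ** Q') ** Q"
    by (simp only: matrix_mul_assoc)
  then have "(P ** P') ** (Q' ** Q) = mat 1" by (simp add: PQ(1) PQ'(1))
  moreover have "A = (P ** P') ** D ** (Q' ** Q)"
    by (simp only: PQ(2) PQ'(2) matrix_mul_assoc)
  ultimately show ?thesis unfolding similar_matrix_iff by blast
qed

lemma similar_matrix_scalar_mult:
  fixes A B :: "'a::comm_ring_1 ^ 2 ^ 2"
  assumes "similar_matrix A B"
  shows "similar_matrix (mat t ** A) (mat t ** B)"
proof -
  obtain P Q where PQ: "P ** Q = mat 1" "A = P ** B ** Q"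
    using assms unfolding similar_matrix_iff by blast
  have "mat t ** A = (mat t ** P) ** B ** Q"
    by (simp only: PQ(2) matrix_mul_assoc)
  also have "\<dots> = P ** (mat t ** B) ** Q"
    by (simp only: mat_commute[of t P] matrix_mul_assoc)
  finally show ?thesis using PQ(1) unfolding similar_matrix_iff by blast
qed

lemma trace_similar:
  fixes A B :: "'a::comm_ring_1 ^ 2 ^ 2"
  assumes "similar_matrix A B"
  shows "trace A = trace B"
proof -
  obtain P Q where PQ: "P ** Q = mat 1" "A = P ** B ** Q"
    using assms unfolding similar_matrix_iff by blast
  have "trace A = trace (Q ** P ** B)"
    by (metis PQ(2) trace_mul_sym matrix_mul_assoc)
  then show ?thesis by (simp add: right_inverse_imp_left_inverse[OF PQ(1)])
qed

lemma det_similar: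
  fixes A B :: "'a::comm_ring_1 ^ 2 ^ 2"
  assumes "similar_matrix A B"
  shows "det A = det B"
proof -
  obtain P Q where PQ: "P ** Q = mat 1" "A = P ** B ** Q"
    using assms unfolding similar_matrix_iff by blast
  have "det A = det (P ** Q) * det B" by (simp add: PQ(2) det_mul ac_simps)
  then show ?thesis by (simp add: PQ(1))
qed

lemma similarity_orbit_eq: "similarity_orbit C = {A. similar_matrix A C}"
  unfolding similarity_orbit_def similar_matrix_def by blast

section \<open>Reduction to companion matrices\<close>

definition companion :: "'a::comm_ring_1 \<Rightarrow> 'a \<Rightarrow> 'a ^ 2 ^ 2" where
  "companion \<tau> \<nu> = matrix2 0 (- \<nu>) 1 \<tau>"

text \<open>
  With \<open>P\<close> the matrix with columns \<open>v\<close> and \<open>C v\<close>, the first columns of \<open>C P\<close> and of \<open>P\<close> times the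
  companion matrix agree by construction, the second ones by Cayley-Hamilton. Surjectivity of
  \<open>P\<close> already makes \<open>P\<close> invertible.
\<close>

lemma cyclic_similar_companion:
  fixes C :: "'a::comm_ring_1 ^ 2 ^ 2"
  assumes "cyclic_matrix C"
  shows "similar_matrix C (companion (trace C) (det C))"
proof -
  obtain v where v: "basis_pair v (C *v v)"
    using assms unfolding cyclic_matrix_def by blast
  obtain a b c d where C: "C = matrix2 a b c d" by (rule matrix2_cases)
  define p q where "p = v $ 1" and "q = v $ 2"
  have Cv: "(C *v v) $ 1 = a * p + b * q" "(C *v v) $ 2 = c * p + d * q"
    by (simp_all add: C p_def q_def matrix_vector_mult_def sum_2)
  define P where "P = matrix2 p (a * p + b * q) q (c * p + d * q)"
  have span: "\<exists>y z. x = y *s v + z *s (C *v v)" for x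
    using v unfolding basis_pair_iff by blast
  obtain y z where 1: "vector [1, 0] = y *s v + z *s (C *v v)" using span by blast
  obtain y' z' where 2: "vector [0, 1] = y' *s v + z' *s (C *v v)" using span by blast
  define Q where "Q = matrix2 y y' z z'"
  have "P ** Q = mat 1"
    using 1 2 by (simp add: P_def Q_def mat_eq_matrix2 vec_eq_iff forall_2 Cv mult.commute
        flip: p_def q_def)
  moreover have "C ** P = P ** companion (trace C) (det C)"
    by (simp add: C P_def companion_def algebra_simps)
  ultimately have "P ** companion (trace C) (det C) ** Q = C"
    by (metis matrix_mul_assoc matrix_mul_rid)
  with \<open>P ** Q = mat 1\<close> show ?thesis unfolding similar_matrix_iff by metis
qed

text \<open>
  The conjugating matrix is the diagonal matrix with entries \<open>1\<close> and \<open>t\<close>; the two equations say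
  that \<open>t \<nu> = t\<^sup>-\<^sup>1 \<nu>\<close> and \<open>t \<tau> = \<tau>\<close>.
\<close>

lemma companion_scalar_symmetry:
  fixes t \<tau> \<nu> :: "'a::comm_ring_1"
  assumes "t dvd 1" and \<tau>: "(t - 1) * \<tau> = 0" and \<nu>: "(t\<^sup>2 - 1) * \<nu> = 0"
  shows "similar_matrix (mat t ** companion \<tau> \<nu>) (companion \<tau> \<nu>)"
proof -
  obtain s where s: "t * s = 1" using assms(1) by (metis dvdE)
  have "t * \<nu> = t * \<nu> * (t * s) - s * ((t\<^sup>2 - 1) * \<nu>)"
    by (simp add: s \<nu>)
  also have "\<dots> = s * \<nu>" by (simp add: algebra_simps power2_eq_square)
  finally have "t * \<nu> = s * \<nu>" .
  moreover have "t * \<tau> = \<tau>" using \<tau> by (simp add: algebra_simps)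
  moreover from this have "\<tau> * s = \<tau> * (t * s)" by (metis mult.assoc mult.commute)
  then have "\<tau> * s = \<tau>" by (simp add: s)
  ultimately have "mat t ** companion \<tau> \<nu> = matrix2 1 0 0 t ** companion \<tau> \<nu> ** matrix2 1 0 0 s"
    by (simp add: companion_def mat_eq_matrix2 mult.commute)
  moreover have "matrix2 1 0 0 t ** matrix2 1 0 0 s = mat 1"
    by (simp add: mat_eq_matrix2 s)
  ultimately show ?thesis unfolding similar_matrix_iff by blast
qed

section \<open>The left stabilizer consists of scalars\<close>

text \<open>
  For \<open>L\<close> the conjugate of the companion matrix by the unipotent matrix with corner entry \<open>x\<close>,
  the trace of \<open>H L\<close> is \<open>b - c \<nu> + d \<tau> + (a - d + c \<tau>) x - c x\<^sup>2\<close>. Its second difference at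
  \<open>0\<close> is \<open>- 2 c\<close>, which yields \<open>c = 0\<close> and then \<open>a = d\<close>. The conjugate by the diagonal matrix
  \<open>(1, -1)\<close> changes the sign of \<open>b\<close>, whence \<open>2 b = 0\<close>.
\<close>

lemma trace_stabilizer_scalar:
  fixes H :: "'a::comm_ring_1 ^ 2 ^ 2"
  assumes two: "(2::'a) dvd 1"
    and tr: "\<And>L. similar_matrix L (companion \<tau> \<nu>) \<Longrightarrow> trace (H ** L) = \<tau>"
  shows "\<exists>t. H = mat t"
proof -
  have cancel: "x = 0" if "x + x = 0" for x :: 'a
  proof -
    obtain h :: 'a where "1 = 2 * h" using two by (rule dvdE)
    then have "x = (2 * h) * x" by simp
    also have "\<dots> = h * (x + x)" by (simp add: algebra_simps)
    finally show ?thesis by (simp add: that)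
  qed
  obtain a b c d where H: "H = matrix2 a b c d" by (rule matrix2_cases)
  have "similar_matrix (matrix2 x (x * \<tau> - \<nu> - x * x) 1 (\<tau> - x)) (companion \<tau> \<nu>)" for x
    unfolding similar_matrix_iff
    by (intro exI[of _ "matrix2 1 x 0 1"] exI[of _ "matrix2 1 (- x) 0 1"])
       (simp add: companion_def mat_eq_matrix2 algebra_simps)
  from tr[OF this]
  have unipotent: "a * x + b + (c * (x * \<tau> - \<nu> - x * x) + d * (\<tau> - x)) = \<tau>" for x
    by (simp add: H)
  have "similar_matrix (matrix2 0 \<nu> (- 1) \<tau>) (companion \<tau> \<nu>)"
    unfolding similar_matrix_iff
    by (intro exI[of _ "matrix2 1 0 0 (- 1)"]) (simp add: companion_def mat_eq_matrix2)
  from tr[OF this] have diagonal: "- b + (c * \<nu> + d * \<tau>) = \<tau>"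
    by (simp add: H)
  have at0: "b - c * \<nu> + d * \<tau> = \<tau>"
    using unipotent[of 0] by (simp add: algebra_simps)
  have at1: "(b - c * \<nu> + d * \<tau>) + (a - d + c * \<tau>) - c = \<tau>"
    using unipotent[of 1] by (simp add: algebra_simps)
  have atm1: "(b - c * \<nu> + d * \<tau>) - (a - d + c * \<tau>) - c = \<tau>"
    using unipotent[of "- 1"] by (simp add: algebra_simps)
  have eq1: "a - d + c * \<tau> = c" using at0 at1 by (simp add: algebra_simps)
  have eqm1: "a - d + c * \<tau> = - c" using at0 atm1 by (simp add: algebra_simps)
  from eq1 eqm1 have "c + c = 0" by simp
  then have c: "c = 0" by (rule cancel)
  with eq1 have ad: "a = d" by simp
  have "b + d * \<tau> = - b + d * \<tau>" using at0 diagonal c by simp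
  then have "b = - b" by simp
  then have "b + b = 0" by (metis add.right_inverse)
  then have b: "b = 0" by (rule cancel)
  show ?thesis unfolding H mat_eq_matrix2 using b c ad by blast
qed

text \<open>
  Scalars are central, so multiplication by \<open>t\<close> maps the orbit of \<open>C\<close> into itself as soon as
  \<open>t C\<close> lies in it. Surjectivity comes from the same similarity scaled by \<open>t\<^sup>-\<^sup>1\<close>.
\<close>

lemma scalar_mem_left_stabilizer_iff:
  fixes C :: "'a::comm_ring_1 ^ 2 ^ 2"
  shows "mat t \<in> left_stabilizer C \<longleftrightarrow> t \<in> scalar_symmetry_group C"
proof
  assume t: "mat t \<in> left_stabilizer C"
  then have "mat t ** C \<in> similarity_orbit C"
    unfolding left_stabilizer_def using similar_matrix_refl[of C] similarity_orbit_eq[of C] by blast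
  with t show "t \<in> scalar_symmetry_group C"
    by (simp add: left_stabilizer_def scalar_symmetry_group_def scalar_matrix_invertible_iff
        map_matrix_times similarity_orbit_eq)
next
  assume "t \<in> scalar_symmetry_group C"
  then have t: "t dvd 1" and sim: "similar_matrix (mat t ** C) C"
    by (auto simp: scalar_symmetry_group_def map_matrix_times)
  obtain s where s: "t * s = 1" using t by (metis dvdE)
  have cancel: "mat s ** (mat t ** A) = A" "mat t ** (mat s ** A) = A" for A :: "'a ^ 2 ^ 2"
    using s by (simp_all add: matrix_mul_assoc mat_mult_mat mult.commute)
  have into: "similar_matrix (mat t ** A) C" if "similar_matrix A C" for A
    using similar_matrix_trans[OF similar_matrix_scalar_mult[OF that] sim] .
  have "similar_matrix (mat s ** C) C"
    using similar_matrix_sym[OF similar_matrix_scalar_mult[OF sim, of s]] similar_matrix_sym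
    by (metis cancel(1))
  then have preimage: "similar_matrix (mat s ** A) C" if "similar_matrix A C" for A
    using similar_matrix_trans[OF similar_matrix_scalar_mult[OF that]] by blast
  have "A \<in> (\<lambda>K. mat t ** K) ` similarity_orbit C" if "similar_matrix A C" for A
    using preimage[OF that]
    by (intro image_eqI[of _ _ "mat s ** A"]) (simp_all add: cancel similarity_orbit_eq)
  with into have "(\<lambda>K. mat t ** K) ` similarity_orbit C = similarity_orbit C"
    by (auto simp: similarity_orbit_eq)
  then show "mat t \<in> left_stabilizer C"
    by (simp add: left_stabilizer_def scalar_matrix_invertible_iff t)
qed

lemma scalar_symmetry_group_eq:
  fixes C :: "'a::comm_ring_1 ^ 2 ^ 2"
  assumes "cyclic_matrix C"
  shows "scalar_symmetry_group C =
    {t. t dvd 1 \<and> (t - 1) * trace C = 0 \<and> (t\<^sup>2 - 1) * det C = 0}"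
proof (intro equalityI subsetI CollectI conjI)
  fix t assume "t \<in> scalar_symmetry_group C"
  then have t: "t dvd 1" and sim: "similar_matrix (mat t ** C) C"
    by (auto simp: scalar_symmetry_group_def map_matrix_times)
  show "t dvd 1" by (rule t)
  obtain a b c d where C: "C = matrix2 a b c d" by (rule matrix2_cases)
  show "(t - 1) * trace C = 0"
    using trace_similar[OF sim] by (simp add: C mat_eq_matrix2 algebra_simps)
  show "(t\<^sup>2 - 1) * det C = 0"
    using det_similar[OF sim] by (simp add: C mat_eq_matrix2 algebra_simps power2_eq_square)
next
  fix t assume "t \<in> {t. t dvd 1 \<and> (t - 1) * trace C = 0 \<and> (t\<^sup>2 - 1) * det C = 0}"
  then have t: "t dvd 1" "(t - 1) * trace C = 0" "(t\<^sup>2 - 1) * det C = 0" by auto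
  let ?K = "companion (trace C) (det C)"
  have CK: "similar_matrix C ?K" by (rule cyclic_similar_companion[OF assms])
  have "similar_matrix (mat t ** C) (mat t ** ?K)" by (rule similar_matrix_scalar_mult[OF CK])
  then have "similar_matrix (mat t ** C) C"
    using companion_scalar_symmetry[OF t] similar_matrix_sym[OF CK] similar_matrix_trans by blast
  with t(1) show "t \<in> scalar_symmetry_group C"
    by (simp add: scalar_symmetry_group_def map_matrix_times)
qed

theorem theorem2p13:
  fixes C :: "'a::comm_ring_1 ^ 2 ^ 2" and \<tau> \<nu> :: 'a
  assumes two_unit: "(2::'a) dvd 1"
    and cyclic: "cyclic_matrix C"
    and tau: "\<tau> = trace C"
    and nu: "\<nu> = det C"
  shows "left_stabilizer C = mat ` scalar_symmetry_group C
    \<and> mat ` scalar_symmetry_group C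
        = {mat t | t. t dvd 1 \<and> (t - 1) * \<tau> = 0 \<and> (t\<^sup>2 - 1) * \<nu> = 0}"
proof
  have scalar: "\<exists>t. H = mat t" if H: "H \<in> left_stabilizer C" for H
  proof (rule trace_stabilizer_scalar[OF two_unit])
    fix L assume "similar_matrix L (companion \<tau> \<nu>)"
    then have "similar_matrix L C"
      using similar_matrix_sym[OF cyclic_similar_companion[OF cyclic]] similar_matrix_trans
      unfolding tau nu by blast
    then have "similar_matrix (H ** L) C"
      using H unfolding left_stabilizer_def similarity_orbit_eq by blast
    then show "trace (H ** L) = \<tau>" unfolding tau by (rule trace_similar)
  qed
  show "left_stabilizer C = mat ` scalar_symmetry_group C"
  proof (intro equalityI subsetI)
    fix H assume H: "H \<in> left_stabilizer C"
    with scalar obtain t where "H = mat t" by blast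
    with H show "H \<in> mat ` scalar_symmetry_group C"
      by (simp add: scalar_mem_left_stabilizer_iff)
  next
    fix H :: "'a ^ 2 ^ 2" assume "H \<in> mat ` scalar_symmetry_group C"
    then show "H \<in> left_stabilizer C" by (auto simp: scalar_mem_left_stabilizer_iff)
  qed
  show "mat ` scalar_symmetry_group C
      = {mat t | t. t dvd 1 \<and> (t - 1) * \<tau> = 0 \<and> (t\<^sup>2 - 1) * \<nu> = 0}"
    unfolding scalar_symmetry_group_eq[OF cyclic] tau nu by blast
qed

end
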